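(* Let $t\ge 2$ and $\ell \ge 1$ be fixed integers. Then \[ \mathscr{I}(W_{2t+1}) \le \frac{\alpha(W_{2t+1}^{\Box \ell}\Box K_3)}{3(2t+2)^{\ell}}.\]
   Context: All graphs are finite and simple. $W_{n}$ denotes the $n$-wheel, the join of the cycle $C_{n}$ with a single vertex $K_1$ (so $W_{2t+1}$ has $2t+2$ vertices). The Cartesian product $G \Box H$ has vertex set $V(G)\times V(H)$, with $(u,x)$ adjacent to $(v,y)$ if and only if either $u=v$ and $xy\in E(H)$, or $x=y$ and $uv\in E(G)$. Set $G^{\Box 1}=G$ and $G^{\Box k}=G^{\Box (k-1)}\Box G$ for $k\ge 2$. $\alpha(G)$ is the independence number of $G$, and $K_3$ is the complete graph on $3$ vertices. The independence ratio is $i(G)=\alpha(G)/|V(G)|$, and the ultimate independence ratio is $\mathscr{I}(G)=\lim_{m\to\infty} i(G^{\Box m})$; this limit exists because $i(G^{\Box (m+1)})\le i(G^{\Box m})$ for all $m$. *)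

theory Defs
  imports "HOL-Analysis.Analysis" "Graph_Theory.Graph_Theory"
begin

text \<open>
  Finite simple graphs are represented, as in the Graph Theory entry, by the locale
  \<^locale>\<open>pair_graph\<close>: finite, loop-free, symmetric sets of pairs as edges.
\<close>

definition complete_graph :: "nat \<Rightarrow> nat pair_pre_digraph" where
  "complete_graph n =
    \<lparr> pverts = {..<n}, parcs = {(i, j). i < n \<and> j < n \<and> i \<noteq> j} \<rparr>"

text \<open>Only meaningful for \<open>n \<ge> 3\<close>.\<close>

definition cycle_graph :: "nat \<Rightarrow> nat pair_pre_digraph" where
  "cycle_graph n =
    \<lparr> pverts = {..<n},
      parcs = {(i, j). i < n \<and> j < n \<and> (j = Suc i mod n \<or> i = Suc j mod n)} \<rparr>"

definition graph_join ::
    "'a pair_pre_digraph \<Rightarrow> 'b pair_pre_digraph \<Rightarrow> ('a + 'b) pair_pre_digraph" where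
  "graph_join G H =
    \<lparr> pverts = pverts G <+> pverts H,
      parcs = map_prod Inl Inl ` parcs G \<union> map_prod Inr Inr ` parcs H
        \<union> (Inl ` pverts G \<times> Inr ` pverts H) \<union> (Inr ` pverts H \<times> Inl ` pverts G) \<rparr>"

definition wheel :: "nat \<Rightarrow> (nat + nat) pair_pre_digraph" where
  "wheel n = graph_join (cycle_graph n) (complete_graph 1)"

definition cart_prod ::
    "'a pair_pre_digraph \<Rightarrow> 'b pair_pre_digraph \<Rightarrow> ('a \<times> 'b) pair_pre_digraph" (infixl "\<box>" 70) where
  "G \<box> H =
    \<lparr> pverts = pverts G \<times> pverts H,
      parcs = {((u, x), (v, y)). u \<in> pverts G \<and> v \<in> pverts G \<and> x \<in> pverts H \<and> y \<in> pverts H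
        \<and> (u = v \<and> (x, y) \<in> parcs H \<or> x = y \<and> (u, v) \<in> parcs G)} \<rparr>"

definition relabel :: "('a \<Rightarrow> 'b) \<Rightarrow> 'a pair_pre_digraph \<Rightarrow> 'b pair_pre_digraph" where
  "relabel f G = \<lparr> pverts = f ` pverts G, parcs = map_prod f f ` parcs G \<rparr>"

text \<open>
  The type of the vertices of an iterated product \<open>((G \<box> G) \<box> \<dots>) \<box> G\<close> depends on the number
  of factors. To obtain powers with a variable exponent in a single type, nested pairs are
  relabelled injectively as lists; see \<open>box_power_one_iso\<close> and \<open>box_power_Suc_iso\<close> below.
  The exponent \<open>0\<close> is only there to make the function total.
\<close>

fun box_power :: "'a pair_pre_digraph \<Rightarrow> nat \<Rightarrow> 'a list pair_pre_digraph" where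
  "box_power G 0 = \<lparr> pverts = {[]}, parcs = {} \<rparr>"
| "box_power G (Suc 0) = relabel (\<lambda>v. [v]) G"
| "box_power G (Suc (Suc k)) = relabel (\<lambda>(vs, v). vs @ [v]) (box_power G (Suc k) \<box> G)"

definition independent_set :: "'a pair_pre_digraph \<Rightarrow> 'a set \<Rightarrow> bool" where
  "independent_set G S \<longleftrightarrow> S \<subseteq> pverts G \<and> (\<forall>u\<in>S. \<forall>v\<in>S. (u, v) \<notin> parcs G)"

definition independence_number :: "'a pair_pre_digraph \<Rightarrow> nat" where
  "independence_number G = Max (card ` {S. independent_set G S})"

definition independence_ratio :: "'a pair_pre_digraph \<Rightarrow> real" where
  "independence_ratio G = real (independence_number G) / real (card (pverts G))"

text \<open>The limit exists for every finite graph, see \<open>ultimate_independence_ratio_LIMSEQ\<close>.\<close>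

definition ultimate_independence_ratio :: "'a pair_pre_digraph \<Rightarrow> real" where
  "ultimate_independence_ratio G = lim (\<lambda>m. independence_ratio (box_power G m))"


subsection \<open>The constructions yield the intended graphs\<close>

lemma pair_graphI:
  assumes "finite (pverts G)" "parcs G \<subseteq> pverts G \<times> pverts G"
    and "\<And>u. (u, u) \<notin> parcs G" "\<And>u v. (u, v) \<in> parcs G \<Longrightarrow> (v, u) \<in> parcs G"
  shows "pair_graph G"
proof -
  have "finite (parcs G)"
    using assms(1,2) by (meson finite_SigmaI finite_subset)
  then show ?thesis
    using assms by unfold_locales (auto simp: symmetric_def intro: symI)
qed

lemma pair_graphD:
  assumes "pair_graph G"
  shows "finite (pverts G)" "parcs G \<subseteq> pverts G \<times> pverts G"
    and "(u, u) \<notin> parcs G" "(u, v) \<in> parcs G \<Longrightarrow> (v, u) \<in> parcs G"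
proof -
  interpret pair_graph G by fact
  show "finite (pverts G)" "parcs G \<subseteq> pverts G \<times> pverts G"
    by (auto simp: pair_finite_verts dest: in_arcsD1 in_arcsD2)
  show "(u, u) \<notin> parcs G" using pair_no_loops by force
  show "(u, v) \<in> parcs G \<Longrightarrow> (v, u) \<in> parcs G"
    using pair_sym_arcs by (auto simp: symmetric_def dest: symD)
qed

lemma complete_graph_complete_digraph: "complete_digraph n (with_proj (complete_graph n))"
  by (auto simp: complete_digraph_pair_def complete_graph_def)

lemma pair_graph_complete_graph: "pair_graph (complete_graph n)"
  by (rule pair_graphI) (auto simp: complete_graph_def)

lemma pair_graph_cycle_graph: "n \<ge> 2 \<Longrightarrow> pair_graph (cycle_graph n)"
  by (rule pair_graphI) (auto simp: cycle_graph_def mod_Suc)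

lemma pair_graph_graph_join:
  assumes "pair_graph G" "pair_graph H"
  shows "pair_graph (graph_join G H)"
proof (rule pair_graphI)
  show "finite (pverts (graph_join G H))"
    using pair_graphD(1)[OF assms(1)] pair_graphD(1)[OF assms(2)] by (simp add: graph_join_def)
  show "parcs (graph_join G H) \<subseteq> pverts (graph_join G H) \<times> pverts (graph_join G H)"
    using pair_graphD(2)[OF assms(1)] pair_graphD(2)[OF assms(2)] by (auto simp: graph_join_def)
  show "(u, u) \<notin> parcs (graph_join G H)" for u
    using pair_graphD(3)[OF assms(1)] pair_graphD(3)[OF assms(2)] by (auto simp: graph_join_def)
  show "(u, v) \<in> parcs (graph_join G H) \<Longrightarrow> (v, u) \<in> parcs (graph_join G H)" for u v
    using pair_graphD(4)[OF assms(1)] pair_graphD(4)[OF assms(2)]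
    by (force simp: graph_join_def)
qed

lemma pair_graph_wheel: "n \<ge> 2 \<Longrightarrow> pair_graph (wheel n)"
  by (simp add: wheel_def pair_graph_graph_join pair_graph_cycle_graph pair_graph_complete_graph)

lemma card_pverts_wheel: "card (pverts (wheel n)) = n + 1"
  by (simp add: wheel_def graph_join_def cycle_graph_def complete_graph_def card_Plus)

lemma pair_graph_cart_prod:
  assumes "pair_graph G" "pair_graph H"
  shows "pair_graph (G \<box> H)"
proof (rule pair_graphI)
  show "finite (pverts (G \<box> H))"
    using pair_graphD(1)[OF assms(1)] pair_graphD(1)[OF assms(2)] by (simp add: cart_prod_def)
qed (auto simp: cart_prod_def pair_graphD[OF assms(1)] pair_graphD[OF assms(2)])

lemma digraph_iso_relabel:
  assumes "pair_graph G" "inj_on f (pverts G)"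
  shows "digraph_iso (with_proj G) (with_proj (relabel f G))"
proof -
  interpret pair_graph G by fact
  have "parcs G \<subseteq> pverts G \<times> pverts G"
    by (rule pair_graphD) fact
  then have "inj_on (map_prod f f) (parcs G)"
    using inj_on_subset[OF map_prod_inj_on[OF assms(2) assms(2)]] by blast
  then have "digraph_isomorphism
      \<lparr> iso_verts = f, iso_arcs = map_prod f f, iso_head = snd, iso_tail = fst \<rparr>"
    using assms(2) wf_digraph by (simp add: digraph_isomorphism_def)
  then show ?thesis
    unfolding digraph_iso_def
    by (intro exI[of _ "\<lparr> iso_verts = f, iso_arcs = map_prod f f,
      iso_head = snd, iso_tail = fst \<rparr>"]) (auto simp: app_iso_def relabel_def with_proj_def)
qed

lemma pair_graph_relabel:
  assumes "pair_graph G" "inj_on f (pverts G)"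
  shows "pair_graph (relabel f G)"
proof (rule pair_graphI)
  show "(u, u) \<notin> parcs (relabel f G)" for u
    using pair_graphD(2,3)[OF assms(1)] assms(2) by (auto simp: relabel_def dest: inj_onD)
qed (use pair_graphD[OF assms(1)] in \<open>force simp: relabel_def\<close>)+

lemma pair_graph_box_power: "pair_graph G \<Longrightarrow> pair_graph (box_power G k)"
proof (induction G k rule: box_power.induct)
  case (1 G)
  show ?case by (rule pair_graphI) auto
next
  case (2 G)
  then show ?case by (auto intro!: pair_graph_relabel inj_onI)
next
  case (3 G k)
  then show ?case by (auto intro!: pair_graph_relabel pair_graph_cart_prod inj_onI)
qed

lemma box_power_one_iso:
  "pair_graph G \<Longrightarrow> digraph_iso (with_proj G) (with_proj (box_power G 1))"
  by (auto intro!: digraph_iso_relabel inj_onI)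

lemma box_power_Suc_iso:
  assumes "pair_graph G" "k \<ge> 1"
  shows "digraph_iso (with_proj (box_power G k \<box> G)) (with_proj (box_power G (Suc k)))"
proof -
  obtain j where "k = Suc j" using assms(2) by (cases k) auto
  then show ?thesis
    using assms(1)
    by (auto intro!: digraph_iso_relabel pair_graph_cart_prod pair_graph_box_power inj_onI)
qed


subsection \<open>Existence of the limit\<close>

lemma
  assumes "finite (pverts G)"
  shows independence_number_attained:
      "\<exists>S. independent_set G S \<and> card S = independence_number G"
    and card_le_independence_number:
      "independent_set G S \<Longrightarrow> card S \<le> independence_number G"
proof -
  have "{S. independent_set G S} \<subseteq> Pow (pverts G)" by (auto simp: independent_set_def)
  then have fin: "finite {S. independent_set G S}" using assms by (simp add: finite_subset)
  have "independent_set G {}" by (simp add: independent_set_def)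
  then have "independence_number G \<in> card ` {S. independent_set G S}"
    unfolding independence_number_def using fin by (intro Max_in) auto
  then show "\<exists>S. independent_set G S \<and> card S = independence_number G" by auto
  show "independent_set G S \<Longrightarrow> card S \<le> independence_number G"
    unfolding independence_number_def using fin by (intro Max_ge) auto
qed

lemma independence_number_relabel:
  assumes G: "pair_graph G" and inj: "inj_on f (pverts G)"
  shows "independence_number (relabel f G) = independence_number G"
proof (rule antisym)
  have fin: "finite (pverts G)" by (rule pair_graphD) fact
  then have fin': "finite (pverts (relabel f G))" by (simp add: relabel_def)
  obtain T where T: "independent_set (relabel f G) T"
      "card T = independence_number (relabel f G)"
    using independence_number_attained[OF fin'] by auto
  define S where "S = {v \<in> pverts G. f v \<in> T}"
  have "f ` S = T" using T(1) by (auto simp: S_def independent_set_def relabel_def)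
  moreover have "independent_set G S"
    using T(1) by (force simp: S_def independent_set_def relabel_def)
  moreover have "inj_on f S" using inj by (rule inj_on_subset) (auto simp: S_def)
  ultimately show "independence_number (relabel f G) \<le> independence_number G"
    using card_le_independence_number[OF fin] T(2) by (metis card_image)
  obtain S where S: "independent_set G S" "card S = independence_number G"
    using independence_number_attained[OF fin] by auto
  have sub: "S \<subseteq> pverts G" using S(1) by (simp add: independent_set_def)
  have "independent_set (relabel f G) (f ` S)"
    unfolding independent_set_def
  proof (intro conjI ballI)
    show "f ` S \<subseteq> pverts (relabel f G)" using sub by (auto simp: relabel_def)
    fix a b assume "a \<in> f ` S" "b \<in> f ` S"
    then obtain u v where uv: "u \<in> S" "v \<in> S" "a = f u" "b = f v" by auto
    show "(a, b) \<notin> parcs (relabel f G)"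
    proof
      assume "(a, b) \<in> parcs (relabel f G)"
      then obtain u' v' where e: "(u', v') \<in> parcs G" "f u' = f u" "f v' = f v"
        using uv by (auto simp: relabel_def)
      have "u' \<in> pverts G" "v' \<in> pverts G" using e(1) pair_graphD(2)[OF G] by auto
      then have "u' = u" "v' = v" using e uv sub inj by (auto dest: inj_onD)
      then show False using e(1) uv S(1) by (auto simp: independent_set_def)
    qed
  qed
  moreover have "card (f ` S) = card S"
    using inj sub by (meson card_image inj_on_subset)
  ultimately show "independence_number G \<le> independence_number (relabel f G)"
    using card_le_independence_number[OF fin'] S(2) by metis
qed

lemma card_pverts_relabel:
  "inj_on f (pverts G) \<Longrightarrow> card (pverts (relabel f G)) = card (pverts G)"
  by (simp add: relabel_def card_image)

lemma independence_number_cart_prod_le: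
  assumes "finite (pverts G)" "finite (pverts H)"
  shows "independence_number (G \<box> H) \<le> independence_number G * card (pverts H)"
proof -
  have fin: "finite (pverts (G \<box> H))" using assms by (simp add: cart_prod_def)
  obtain S where S: "independent_set (G \<box> H) S" "card S = independence_number (G \<box> H)"
    using independence_number_attained[OF fin] by auto
  define R where "R x = {u. (u, x) \<in> S}" for x
  have sub: "S \<subseteq> pverts G \<times> pverts H"
    using S(1) by (simp add: independent_set_def cart_prod_def)
  have R: "card (R x) \<le> independence_number G" for x
  proof (rule card_le_independence_number[OF assms(1)])
    show "independent_set G (R x)"
      using S(1) sub unfolding independent_set_def cart_prod_def R_def by fastforce
  qed
  have "S = (\<lambda>(x, u). (u, x)) ` (SIGMA x:pverts H. R x)"
    using sub by (force simp: R_def)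
  then have "card S \<le> card (SIGMA x:pverts H. R x)"
  proof -
    have "finite (SIGMA x:pverts H. R x)"
      using assms sub by (intro finite_SigmaI) (auto simp: R_def intro!: finite_subset[OF _ assms(1)])
    then show ?thesis using \<open>S = _\<close> card_image_le by metis
  qed
  also have "\<dots> = (\<Sum>x\<in>pverts H. card (R x))"
    using assms sub by (intro card_SigmaI) (auto simp: R_def intro!: finite_subset[OF _ assms(1)])
  also have "\<dots> \<le> (\<Sum>x\<in>pverts H. independence_number G)"
    by (intro sum_mono R)
  finally show ?thesis using S(2) by (simp add: mult.commute)
qed

lemma independence_ratio_cart_prod_le:
  assumes "finite (pverts G)" "finite (pverts H)"
  shows "independence_ratio (G \<box> H) \<le> independence_ratio G"
proof (cases "card (pverts H) = 0")
  case False
  have "real (independence_number (G \<box> H)) \<le> real (independence_number G) * real (card (pverts H))"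
    using independence_number_cart_prod_le[OF assms] by (metis of_nat_le_iff of_nat_mult)
  moreover have "card (pverts (G \<box> H)) = card (pverts G) * card (pverts H)"
    by (simp add: cart_prod_def card_cartesian_product)
  ultimately have "independence_ratio (G \<box> H)
      \<le> (real (independence_number G) * real (card (pverts H)))
        / (real (card (pverts G)) * real (card (pverts H)))"
    unfolding independence_ratio_def by (simp only: of_nat_mult) (intro divide_right_mono, auto)
  then show ?thesis using False by (simp add: independence_ratio_def)
qed (simp add: independence_ratio_def cart_prod_def card_cartesian_product)

lemma independence_ratio_box_power_Suc_le:
  assumes "pair_graph G" "k \<ge> 1"
  shows "independence_ratio (box_power G (Suc k)) \<le> independence_ratio (box_power G k)"
proof -
  obtain j where j: "k = Suc j" using assms(2) by (cases k) auto
  have P: "pair_graph (box_power G k)" using assms(1) by (rule pair_graph_box_power)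
  have inj: "inj_on (\<lambda>(vs, v). vs @ [v]) (pverts (box_power G k \<box> G))" by (auto intro!: inj_onI)
  have "independence_ratio (box_power G (Suc k)) = independence_ratio (box_power G k \<box> G)"
    using j independence_number_relabel[OF pair_graph_cart_prod[OF P assms(1)] inj]
      card_pverts_relabel[OF inj] by (simp add: independence_ratio_def)
  also have "\<dots> \<le> independence_ratio (box_power G k)"
    by (intro independence_ratio_cart_prod_le pair_graphD(1) P assms(1))
  finally show ?thesis .
qed

lemma ultimate_independence_ratio_LIMSEQ:
  assumes "pair_graph G"
  shows "(\<lambda>m. independence_ratio (box_power G m)) \<longlonglongrightarrow> ultimate_independence_ratio G"
proof -
  let ?X = "\<lambda>m. independence_ratio (box_power G (Suc m))"
  have dec: "decseq ?X"
    by (rule decseq_SucI) (rule independence_ratio_box_power_Suc_le[OF assms], simp)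
  have "\<forall>m. 0 \<le> ?X m" by (simp add: independence_ratio_def)
  then obtain L where "?X \<longlonglongrightarrow> L" using decseq_convergent[OF dec] by blast
  then have "(\<lambda>m. independence_ratio (box_power G m)) \<longlonglongrightarrow> L"
    by (rule LIMSEQ_imp_Suc)
  then show ?thesis
    unfolding ultimate_independence_ratio_def by (simp add: limI)
qed

end

theory Submission
  imports Defs
begin

text \<open>
  Only the existence of a homomorphism \<open>f\<close> from \<open>H = K\<^sub>3\<close> to \<open>G = W\<^sub>2\<^sub>t\<^sub>+\<^sub>1\<close> matters. An independent set of
  \<open>G\<^sup>l\<^sup>+\<^sup>N\<close> pulls back to an independent set of \<open>G\<^sup>l \<box> H\<close> whenever all but one of the last \<open>N\<close>
  coordinates are fixed and \<open>H\<close> is placed in the remaining one. Summing the resulting bound over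
  all such placements counts a vertex with last coordinates \<open>v\<close> with multiplicity
  \<open>\<Sum>i. card (f -` {v\<^sub>i})\<close>. By the second-moment method this multiplicity is close to its mean
  \<open>N * |H| / |G|\<close> for almost all \<open>v\<close>, so the independence ratio of \<open>G\<^sup>l\<^sup>+\<^sup>N\<close> exceeds that of
  \<open>G\<^sup>l \<box> H\<close> by at most a multiple of \<open>1 / sqrt N\<close>.
\<close>

section \<open>Sums over words\<close>

definition words :: "'a set \<Rightarrow> nat \<Rightarrow> 'a list set" where
  "words V k = {xs. set xs \<subseteq> V \<and> length xs = k}"

lemma finite_words [simp]: "finite V \<Longrightarrow> finite (words V k)"
  by (simp add: words_def finite_lists_length_eq)

lemma card_words: "finite V \<Longrightarrow> card (words V k) = card V ^ k"
  by (simp add: words_def card_lists_length_eq)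

lemma words_0 [simp]: "words V 0 = {[]}"
  by (auto simp: words_def)

lemma words_Suc: "words V (Suc k) = (\<lambda>(x, v). x # v) ` (V \<times> words V k)"
  by (auto simp: words_def length_Suc_conv image_iff)

text \<open>This form matches the recursion of \<open>box_power\<close>, which appends the new
  factor on the right; \<open>words_Suc\<close> instead serves inductions that strip the first
  letter.\<close>

lemma words_Suc_append: "words V (Suc k) = (\<lambda>(v, x). v @ [x]) ` (words V k \<times> V)"
proof (intro set_eqI iffI)
  fix xs assume "xs \<in> words V (Suc k)"
  then show "xs \<in> (\<lambda>(v, x). v @ [x]) ` (words V k \<times> V)"
    by (cases xs rule: rev_cases) (force simp: words_def)+
qed (auto simp: words_def)

lemma sum_words_Suc:
  assumes "finite V"
  shows "(\<Sum>v\<in>words V (Suc k). F v) = (\<Sum>x\<in>V. \<Sum>v\<in>words V k. F (x # v))"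
proof -
  have "inj_on (\<lambda>(x, v). x # v) (V \<times> words V k)"
    by (auto intro!: inj_onI)
  then have "(\<Sum>v\<in>words V (Suc k). F v) = (\<Sum>(x, v)\<in>V \<times> words V k. F (x # v))"
    unfolding words_Suc by (subst sum.reindex) (auto simp: case_prod_unfold)
  then show ?thesis
    by (simp add: sum.cartesian_product)
qed

text \<open>Each word is cut after its first \<open>l\<close> letters, so \<open>I\<close> is the
  disjoint union of its fibres over the suffixes of length \<open>n\<close>.\<close>

lemma card_eq_sum_suffix:
  assumes "finite V" and "I \<subseteq> words V (l + n)"
  shows "card I = (\<Sum>v\<in>words V n. card {u \<in> words V l. u @ v \<in> I})"
proof -
  let ?J = "SIGMA v:words V n. {u \<in> words V l. u @ v \<in> I}"
  have "bij_betw (\<lambda>(v, u). u @ v) ?J I"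
  proof (rule bij_betw_imageI)
    show "inj_on (\<lambda>(v, u). u @ v) ?J"
      unfolding inj_on_def by (clarsimp simp: words_def)
    have "xs \<in> (\<lambda>(v, u). u @ v) ` ?J" if "xs \<in> I" for xs
    proof (rule image_eqI)
      have "set xs \<subseteq> V" "length xs = l + n"
        using that assms(2) by (auto simp: words_def)
      then show "(drop l xs, take l xs) \<in> ?J"
        using that set_take_subset[of l xs] set_drop_subset[of l xs] by (auto simp: words_def)
    qed simp
    then show "(\<lambda>(v, u). u @ v) ` ?J = I"
      by auto
  qed
  then have "card I = card ?J"
    by (simp add: bij_betw_same_card)
  then show ?thesis
    using assms(1) by simp
qed

section \<open>Moments of coordinate sums over words\<close>

text \<open>This is additivity of variance: for a uniformly random word the letters are independent,
  and \<open>\<phi>\<close> is centred. The factor \<open>card V\<close> keeps the exponent at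
  \<open>n\<close>.\<close>

lemma sum_words_sum_list_squared:
  fixes \<phi> :: "'a \<Rightarrow> real"
  assumes "finite V" and mean: "(\<Sum>x\<in>V. \<phi> x) = 0"
  shows "real (card V) * (\<Sum>v\<in>words V n. (sum_list (map \<phi> v))\<^sup>2)
    = real n * real (card V) ^ n * (\<Sum>x\<in>V. (\<phi> x)\<^sup>2)"
proof (induction n)
  case (Suc n)
  let ?S = "\<lambda>v. sum_list (map \<phi> v)" and ?m = "real (card V)"
  have "(\<Sum>v\<in>words V (Suc n). (?S v)\<^sup>2)
      = (\<Sum>x\<in>V. \<Sum>v\<in>words V n. (\<phi> x)\<^sup>2 + 2 * \<phi> x * ?S v + (?S v)\<^sup>2)"
    by (simp add: sum_words_Suc[OF assms(1)] power2_sum add_ac mult_ac)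
  also have "\<dots> = (\<Sum>x\<in>V. (\<phi> x)\<^sup>2) * ?m ^ n + (\<Sum>x\<in>V. \<Sum>v\<in>words V n. 2 * \<phi> x * ?S v)
      + ?m * (\<Sum>v\<in>words V n. (?S v)\<^sup>2)"
    by (simp add: sum.distrib card_words[OF assms(1)] sum_distrib_left mult.commute)
  \<comment> \<open>The mixed terms factor through the sum of \<open>\<phi>\<close>, which is zero
    by \<open>mean\<close>.\<close>
  also have "(\<Sum>x\<in>V. \<Sum>v\<in>words V n. 2 * \<phi> x * ?S v) = (\<Sum>x\<in>V. \<phi> x) * (\<Sum>v\<in>words V n. 2 * ?S v)"
    by (simp add: sum_product mult_ac)
  finally show ?case
    using Suc.IH by (simp add: mean algebra_simps)
qed simp

text \<open>The first absolute moment is bounded through the second by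
  \<open>\<bar>y\<bar> \<le> s + y\<^sup>2 / s\<close>. As the mean of the squares is proportional
  to \<open>n\<close>, the choice \<open>s = sqrt n\<close> gives both terms order
  \<open>sqrt n\<close>.\<close>

lemma sum_words_abs_sum_list_le:
  fixes \<phi> :: "'a \<Rightarrow> real"
  assumes "finite V" "V \<noteq> {}" and mean: "(\<Sum>x\<in>V. \<phi> x) = 0" and "n > 0"
  shows "(\<Sum>v\<in>words V n. \<bar>sum_list (map \<phi> v)\<bar>)
    \<le> sqrt n * real (card V) ^ n * (1 + (\<Sum>x\<in>V. (\<phi> x)\<^sup>2) / card V)"
proof -
  let ?S = "\<lambda>v. sum_list (map \<phi> v)" and ?m = "real (card V)"
  define s where "s = sqrt n"
  have m: "?m > 0" and s: "s > 0" "real n = s * s"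
    using assms by (auto simp: card_gt_0_iff s_def)
  have "\<bar>y\<bar> \<le> s + y\<^sup>2 / s" for y :: real
  proof (cases "\<bar>y\<bar> \<le> s")
    case False
    then have "\<bar>y\<bar> * s \<le> y\<^sup>2"
      by (metis abs_ge_zero le_cases mult_left_mono power2_abs power2_eq_square)
    then have "\<bar>y\<bar> \<le> y\<^sup>2 / s"
      using s(1) by (simp add: pos_le_divide_eq)
    then show ?thesis
      using s(1) by linarith
  qed (use s(1) in \<open>simp add: add_increasing2\<close>)
  then have "(\<Sum>v\<in>words V n. \<bar>?S v\<bar>) \<le> (\<Sum>v\<in>words V n. s + (?S v)\<^sup>2 / s)"
    by (rule sum_mono)
  also have "\<dots> = s * ?m ^ n + (\<Sum>v\<in>words V n. (?S v)\<^sup>2) / s"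
    by (simp add: sum.distrib sum_divide_distrib card_words[OF assms(1)] mult.commute)
  also have "(\<Sum>v\<in>words V n. (?S v)\<^sup>2) = real n * ?m ^ n * (\<Sum>x\<in>V. (\<phi> x)\<^sup>2) / ?m"
    using sum_words_sum_list_squared[OF assms(1) mean, of n] m by (simp add: field_simps)
  also have "s * ?m ^ n + \<dots> / s = s * ?m ^ n * (1 + (\<Sum>x\<in>V. (\<phi> x)\<^sup>2) / ?m)"
    using s(1) m unfolding s(2) by (simp add: field_simps)
  finally show ?thesis
    unfolding s_def .
qed

text \<open>The factor \<open>card V\<close> on the left avoids the exponent \<open>n - 1\<close> on the right.\<close>

lemma sum_words_placements_le:
  fixes F :: "'a list \<Rightarrow> real" and g :: "'a \<Rightarrow> real"
  assumes "finite V"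
    and "\<And>us vs. us @ vs \<in> words V (n - 1) \<Longrightarrow> n > 0 \<Longrightarrow> (\<Sum>x\<in>V. g x * F (us @ x # vs)) \<le> B"
  shows "real (card V) * (\<Sum>v\<in>words V n. F v * sum_list (map g v)) \<le> real n * real (card V) ^ n * B"
  using assms(2)
proof (induction n arbitrary: F)
  case (Suc n)
  let ?m = "real (card V)"
  \<comment> \<open>The first letter \<open>x\<close> is frozen, and the induction hypothesis
    handles placements in the later positions.\<close>
  have rec: "?m * (\<Sum>v\<in>words V n. F (x # v) * sum_list (map g v)) \<le> real n * ?m ^ n * B"
    if x: "x \<in> V" for x
  proof (rule Suc.IH)
    fix us vs assume "us @ vs \<in> words V (n - 1)" "n > 0"
    then show "(\<Sum>y\<in>V. g y * F (x # us @ y # vs)) \<le> B"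
      using Suc.prems[of "x # us" vs] x by (auto simp: words_def)
  qed
  have "(\<Sum>v\<in>words V (Suc n). F v * sum_list (map g v))
      = (\<Sum>x\<in>V. \<Sum>v\<in>words V n. g x * F (x # v))
        + (\<Sum>x\<in>V. \<Sum>v\<in>words V n. F (x # v) * sum_list (map g v))"
    by (simp add: sum_words_Suc[OF assms(1)] sum.distrib algebra_simps)
  also have "(\<Sum>x\<in>V. \<Sum>v\<in>words V n. g x * F (x # v))
      = (\<Sum>v\<in>words V n. \<Sum>x\<in>V. g x * F (x # v))"
    by (rule sum.swap)
  \<comment> \<open>Placements in the first position are the case \<open>us = []\<close> of the
    hypothesis.\<close>
  also have "\<dots> \<le> (\<Sum>v\<in>words V n. B)"
    using Suc.prems[of "[]"] by (intro sum_mono) simp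
  also have "\<dots> = ?m ^ n * B"
    by (simp add: card_words[OF assms(1)])
  finally have "?m * (\<Sum>v\<in>words V (Suc n). F v * sum_list (map g v))
      \<le> ?m * (?m ^ n * B) + (\<Sum>x\<in>V. ?m * (\<Sum>v\<in>words V n. F (x # v) * sum_list (map g v)))"
    by (simp add: mult_left_mono flip: distrib_left sum_distrib_left)
  also have "\<dots> \<le> ?m * (?m ^ n * B) + (\<Sum>x\<in>V. real n * ?m ^ n * B)"
    by (intro add_left_mono sum_mono rec)
  also have "\<dots> = real (Suc n) * ?m ^ Suc n * B"
    by (simp add: algebra_simps)
  finally show ?case .
qed simp


section \<open>Independent sets in powers\<close>

lemma pverts_box_power: "pverts (box_power G k) = words (pverts G) k"
proof (induction G k rule: box_power.induct)
  case (2 G)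
  show ?case by (auto simp: relabel_def words_Suc)
next
  case (3 G k)
  then show ?case
    by (subst words_Suc_append) (simp add: relabel_def cart_prod_def)
qed simp

text \<open>Unfolding the recursion, an arc moves exactly one coordinate along an arc of
  \<open>G\<close>. The condition \<open>k > 0\<close> matters because \<open>k - 1\<close>
  truncates to \<open>0\<close> and would otherwise create arcs on the empty word.\<close>

lemma parcs_box_power:
  assumes "pair_graph G"
  shows "parcs (box_power G k)
    = {(us @ x # vs, us @ y # vs) | us x y vs.
        us @ vs \<in> words (pverts G) (k - 1) \<and> k > 0 \<and> (x, y) \<in> parcs G}"
  using assms
proof (induction G k rule: box_power.induct)
  case (2 G)
  show ?case by (auto simp: relabel_def image_iff)
next
  case (3 G k)
  have sub: "parcs G \<subseteq> pverts G \<times> pverts G"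
    using 3 by (intro pair_graphD)
  note IH = 3(1)[OF 3(2)]
  show ?case (is "?L = ?R")
  proof (intro set_eqI iffI)
    fix e assume "e \<in> ?L"
    then obtain us x vs y where e: "e = (us @ [x], vs @ [y])"
      and "us \<in> words (pverts G) (Suc k)" "x \<in> pverts G"
      and "us = vs \<and> (x, y) \<in> parcs G \<or> x = y \<and> (us, vs) \<in> parcs (box_power G (Suc k))"
      by (auto simp: relabel_def cart_prod_def pverts_box_power)
    \<comment> \<open>Either the newly appended coordinate moves, or an earlier one does.\<close>
    then consider "us = vs" "(x, y) \<in> parcs G" "us \<in> words (pverts G) (Suc k)"
      | as a b bs where "us = as @ a # bs" "vs = as @ b # bs" "x = y" "(a, b) \<in> parcs G"
          "as @ bs \<in> words (pverts G) k" "x \<in> pverts G"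
      unfolding IH by auto
    then show "e \<in> ?R"
    proof cases
      case 1
      then show ?thesis unfolding e by (fastforce simp: words_def)
    next
      case 2
      then have "as @ bs @ [x] \<in> words (pverts G) (Suc k)"
        by (auto simp: words_def)
      with 2 show ?thesis unfolding e by fastforce
    qed
  next
    fix e assume "e \<in> ?R"
    then obtain us x y vs where e: "e = (us @ x # vs, us @ y # vs)"
      and w: "us @ vs \<in> words (pverts G) (Suc k)" and xy: "(x, y) \<in> parcs G"
      by auto
    show "e \<in> ?L"
    proof (cases vs rule: rev_cases)
      case Nil
      then have "((us, x), (us, y)) \<in> parcs (box_power G (Suc k) \<box> G)"
        using w xy sub by (auto simp: cart_prod_def pverts_box_power)
      then have "map_prod (\<lambda>(vs, v). vs @ [v]) (\<lambda>(vs, v). vs @ [v]) ((us, x), (us, y)) \<in> ?L"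
        unfolding box_power.simps relabel_def pair_pre_digraph.simps by (rule imageI)
      then show ?thesis using e Nil by simp
    next
      case (snoc ws z)
      have "us @ ws \<in> words (pverts G) k" "z \<in> pverts G"
        using w snoc by (auto simp: words_def)
      moreover from this have "us @ x # ws \<in> words (pverts G) (Suc k)"
          "us @ y # ws \<in> words (pverts G) (Suc k)"
        using xy sub by (auto simp: words_def)
      ultimately have "((us @ x # ws, z), (us @ y # ws, z)) \<in> parcs (box_power G (Suc k) \<box> G)"
        using xy IH by (fastforce simp: cart_prod_def pverts_box_power)
      then have "map_prod (\<lambda>(vs, v). vs @ [v]) (\<lambda>(vs, v). vs @ [v])
          ((us @ x # ws, z), (us @ y # ws, z)) \<in> ?L"
        unfolding box_power.simps relabel_def pair_pre_digraph.simps by (rule imageI)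
      then show ?thesis using e snoc by simp
    qed
  qed
qed simp

section \<open>Pulling back independent sets along homomorphisms\<close>

lemma independent_set_vimage:
  assumes "independent_set G S"
    and "\<And>u v. (u, v) \<in> parcs H \<Longrightarrow> (f u, f v) \<in> parcs G"
  shows "independent_set H {u \<in> pverts H. f u \<in> S}"
  using assms by (simp add: independent_set_def) blast

text \<open>The map \<open>?f\<close> inserts \<open>f y\<close> between the fixed words
  \<open>us\<close> and \<open>vs\<close> and is a homomorphism into the power. The sum counts the
  preimage of \<open>S\<close>, which is therefore independent.\<close>

lemma card_placement_le:
  assumes G: "pair_graph G" and H: "finite (pverts H)"
    and f: "f ` pverts H \<subseteq> pverts G" "\<And>x y. (x, y) \<in> parcs H \<Longrightarrow> (f x, f y) \<in> parcs G"
    and S: "independent_set (box_power G (l + n)) S"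
    and w: "us @ vs \<in> words (pverts G) (n - 1)" "n > 0"
  shows "(\<Sum>y\<in>pverts H. card {u \<in> words (pverts G) l. u @ us @ f y # vs \<in> S})
    \<le> independence_number (box_power G l \<box> H)"
proof -
  have V: "finite (pverts G)" using G by (rule pair_graphD)
  let ?K = "box_power G l \<box> H" and ?f = "\<lambda>(u, y). u @ us @ f y # vs"
  have hom: "(?f p, ?f q) \<in> parcs (box_power G (l + n))" if pq: "(p, q) \<in> parcs ?K" for p q
  proof -
    obtain u y v z where [simp]: "p = (u, y)" "q = (v, z)" by (cases p; cases q)
    consider "u = v" "u \<in> words (pverts G) l" "(y, z) \<in> parcs H"
      | "y = z" "y \<in> pverts H" "(u, v) \<in> parcs (box_power G l)"
      using pq by (auto simp: cart_prod_def pverts_box_power)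
    then show ?thesis
    proof cases
      case 1
      then have "(u @ us) @ vs \<in> words (pverts G) (l + n - 1)" "(f y, f z) \<in> parcs G"
        using w f(2) by (auto simp: words_def)
      then show ?thesis
        using 1 w(2) unfolding parcs_box_power[OF G]
        by (intro CollectI exI[of _ "u @ us"] exI[of _ "f y"] exI[of _ "f z"] exI[of _ vs]) auto
    next
      case 2
      then obtain as a b bs where e: "u = as @ a # bs" "v = as @ b # bs" "(a, b) \<in> parcs G"
          "as @ bs \<in> words (pverts G) (l - 1)" "l > 0"
        unfolding parcs_box_power[OF G] by auto
      then have "as @ (bs @ us @ f y # vs) \<in> words (pverts G) (l + n - 1)"
        using w f(1) 2 by (auto simp: words_def)
      then show ?thesis
        using 2 e unfolding parcs_box_power[OF G]
        by (intro CollectI exI[of _ as] exI[of _ a] exI[of _ b] exI[of _ "bs @ us @ f y # vs"]) auto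
    qed
  qed
  have "(\<Sum>y\<in>pverts H. card {u \<in> words (pverts G) l. u @ us @ f y # vs \<in> S})
      = card (SIGMA y:pverts H. {u \<in> words (pverts G) l. u @ us @ f y # vs \<in> S})"
    using H V by simp
  \<comment> \<open>The dependent sum lists pairs as \<open>(y, u)\<close>, the product graph as
    \<open>(u, y)\<close>.\<close>
  also have "\<dots> = card {p \<in> pverts ?K. ?f p \<in> S}"
    by (rule bij_betw_same_card[of prod.swap])
      (force intro!: bij_betw_imageI inj_onI simp: cart_prod_def pverts_box_power)
  also have "\<dots> \<le> independence_number ?K"
    using H V
    by (intro card_le_independence_number independent_set_vimage[OF S hom])
      (auto simp: cart_prod_def pverts_box_power)
  finally show ?thesis .
qed

section \<open>Comparison of independence ratios and passage to the limit\<close>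

lemma independence_ratio_box_power_le:
  assumes G: "pair_graph G" and H: "finite (pverts H)" "pverts H \<noteq> {}"
    and f: "f ` pverts H \<subseteq> pverts G" "\<And>x y. (x, y) \<in> parcs H \<Longrightarrow> (f x, f y) \<in> parcs G"
  shows "\<exists>C. \<forall>n>0. independence_ratio (box_power G (l + n))
    \<le> independence_ratio (box_power G l \<box> H) + C / sqrt n"
proof -
  let ?V = "pverts G"
  define m h \<alpha> where "m = real (card ?V)" and "h = real (card (pverts H))"
    and "\<alpha> = real (independence_number (box_power G l \<box> H))"
  define g where "g x = real (card {y \<in> pverts H. f y = x})" for x
  \<comment> \<open>The fibres of \<open>f\<close> partition \<open>pverts H\<close>, so
    \<open>g\<close> has mean \<open>h / m\<close> on \<open>pverts G\<close> and
    \<open>\<phi>\<close> is its centred version.\<close>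
  define \<phi> where "\<phi> x = g x - h / m" for x
  define K where "K = 1 + (\<Sum>x\<in>?V. (\<phi> x)\<^sup>2) / m"
  have V: "finite ?V" using G by (rule pair_graphD)
  have V': "?V \<noteq> {}" using H(2) f(1) by auto
  have m: "m > 0" using V V' by (simp add: m_def card_gt_0_iff)
  have h: "h > 0" using H by (simp add: h_def card_gt_0_iff)
  have sum_g: "(\<Sum>x\<in>?V. g x * F x) = (\<Sum>y\<in>pverts H. F (f y))" for F :: "_ \<Rightarrow> real"
    using sum.group[OF H(1) V f(1), of "\<lambda>y. F (f y)"] by (simp add: g_def)
  have mean: "(\<Sum>x\<in>?V. \<phi> x) = 0"
    using sum_g[of "\<lambda>_. 1"] m by (simp add: \<phi>_def sum_subtractf h_def m_def)
  have "independence_ratio (box_power G (l + n))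
      \<le> independence_ratio (box_power G l \<box> H) + m * K / h / sqrt n" if n: "n > 0" for n
  proof -
    have "finite (pverts (box_power G (l + n)))"
      using V by (simp add: pverts_box_power)
    then obtain S where S: "independent_set (box_power G (l + n)) S"
        "card S = independence_number (box_power G (l + n))"
      using independence_number_attained by blast
    \<comment> \<open>\<open>F v\<close> is the size of the fibre of \<open>S\<close> over the
      suffix \<open>v\<close>; it is at most the number \<open>m ^ l\<close> of prefixes.\<close>
    define F where "F v = real (card {u \<in> words ?V l. u @ v \<in> S})" for v
    have F: "0 \<le> F v" "F v \<le> m ^ l" for v
    proof -
      have "card {u \<in> words ?V l. u @ v \<in> S} \<le> card (words ?V l)"
        using V by (intro card_mono) auto
      then show "F v \<le> m ^ l"
        by (simp add: F_def m_def card_words[OF V] flip: of_nat_power)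
    qed (simp add: F_def)
    have card_S: "real (card S) = (\<Sum>v\<in>words ?V n. F v)"
      using S(1) card_eq_sum_suffix[OF V, of S l n]
      by (simp add: F_def independent_set_def pverts_box_power)
    have placed: "m * (\<Sum>v\<in>words ?V n. F v * sum_list (map g v)) \<le> real n * m ^ n * \<alpha>"
      unfolding m_def
    proof (rule sum_words_placements_le[OF V])
      fix us vs assume "us @ vs \<in> words ?V (n - 1)" "n > 0"
      from card_placement_le[OF G H(1) f S(1) this]
      show "(\<Sum>x\<in>?V. g x * F (us @ x # vs)) \<le> \<alpha>"
        unfolding sum_g F_def \<alpha>_def by (simp flip: of_nat_sum)
    qed
    have split: "sum_list (map g v) = real n * (h / m) + sum_list (map \<phi> v)"
      if "v \<in> words ?V n" for v
    proof -
      have "sum_list (map \<phi> v) = sum_list (map g v) - real (length v) * (h / m)"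
        by (induction v) (simp_all add: \<phi>_def algebra_simps add_divide_distrib)
      with that show ?thesis by (simp add: words_def)
    qed
    have "(\<Sum>v\<in>words ?V n. F v * sum_list (map g v))
        = real n * (h / m) * card S + (\<Sum>v\<in>words ?V n. F v * sum_list (map \<phi> v))"
      by (simp add: split card_S distrib_left sum.distrib sum_distrib_left sum_divide_distrib mult_ac)
    \<comment> \<open>Since \<open>F\<close> lies between \<open>0\<close> and \<open>m ^ l\<close>,
      deviations of the multiplicity from its mean can lower the weighted sum by at most
      \<open>m ^ l\<close> times their absolute sum.\<close>
    moreover have "- (\<Sum>v\<in>words ?V n. F v * sum_list (map \<phi> v))
        \<le> (\<Sum>v\<in>words ?V n. m ^ l * \<bar>sum_list (map \<phi> v)\<bar>)"
      unfolding sum_negf[symmetric]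
    proof (rule sum_mono)
      fix v
      have "- (F v * sum_list (map \<phi> v)) \<le> F v * \<bar>sum_list (map \<phi> v)\<bar>"
        using F(1)[of v] by (metis abs_ge_minus_self abs_mult abs_of_nonneg)
      also have "\<dots> \<le> m ^ l * \<bar>sum_list (map \<phi> v)\<bar>"
        by (intro mult_right_mono F) simp
      finally show "- (F v * sum_list (map \<phi> v)) \<le> m ^ l * \<bar>sum_list (map \<phi> v)\<bar>" .
    qed
    moreover have "\<dots> \<le> m ^ l * (sqrt n * m ^ n * K)"
      using sum_words_abs_sum_list_le[OF V V' mean n] m
      by (simp add: K_def m_def flip: sum_distrib_left)
    ultimately have "real n * (h / m) * card S
        \<le> (\<Sum>v\<in>words ?V n. F v * sum_list (map g v)) + m ^ l * (sqrt n * m ^ n * K)"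
      by linarith
    also have "(\<Sum>v\<in>words ?V n. F v * sum_list (map g v)) \<le> real n * m ^ n * \<alpha> / m"
      using placed m by (simp add: field_simps)
    finally have bound: "real n * (h / m) * card S
        \<le> real n * m ^ n * \<alpha> / m + m ^ l * (sqrt n * m ^ n * K)"
      by simp
    define s where "s = sqrt n"
    have s: "s > 0" "real n = s * s" using n by (auto simp: s_def)
    \<comment> \<open>Normalising by the mean multiplicity \<open>n * (h / m)\<close> turns the main
      term into the ratio of the product with \<open>H\<close> and the error into
      \<open>m * K / h / sqrt n\<close>.\<close>
    have "card S / m ^ (l + n) = real n * (h / m) * card S / (real n * (h / m) * m ^ (l + n))"
      using n h m by simp
    also have "\<dots> \<le> (real n * m ^ n * \<alpha> / m + m ^ l * (sqrt n * m ^ n * K))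
        / (real n * (h / m) * m ^ (l + n))"
      using h m by (intro divide_right_mono bound) simp
    also have "\<dots> = \<alpha> / (m ^ l * h) + m * K / h / sqrt n"
      using h m s unfolding s_def[symmetric] s(2) by (simp add: field_simps power_add)
    finally show ?thesis
      by (simp add: independence_ratio_def S(2) \<alpha>_def m_def h_def pverts_box_power
          card_words[OF V] cart_prod_def card_cartesian_product)
  qed
  then show ?thesis by blast
qed

text \<open>With \<open>l\<close> fixed and \<open>n\<close> tending to infinity the error
  \<open>C / sqrt n\<close> vanishes, since \<open>C\<close> does not depend on
  \<open>n\<close>.\<close>

lemma ultimate_independence_ratio_le_homomorphism:
  assumes G: "pair_graph G" and H: "finite (pverts H)" "pverts H \<noteq> {}"
    and f: "f ` pverts H \<subseteq> pverts G" "\<And>x y. (x, y) \<in> parcs H \<Longrightarrow> (f x, f y) \<in> parcs G"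
  shows "ultimate_independence_ratio G \<le> independence_ratio (box_power G l \<box> H)"
proof -
  let ?i = "independence_ratio (box_power G l \<box> H)"
  obtain C where C: "independence_ratio (box_power G (l + n)) \<le> ?i + C / sqrt n" if "n > 0" for n
    using independence_ratio_box_power_le[OF G H f, of l] by blast
  have "(\<lambda>n. independence_ratio (box_power G (l + n))) \<longlonglongrightarrow> ultimate_independence_ratio G"
    using LIMSEQ_ignore_initial_segment[OF ultimate_independence_ratio_LIMSEQ[OF G], of l]
    by (simp add: add.commute)
  moreover have "filterlim (\<lambda>n. sqrt (real n)) at_infinity sequentially"
    by (intro filterlim_at_top_imp_at_infinity
        filterlim_compose[OF sqrt_at_top filterlim_real_sequentially])
  then have "(\<lambda>n. ?i + C / sqrt n) \<longlonglongrightarrow> ?i + 0"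
    by (intro tendsto_add tendsto_const tendsto_divide_0[OF tendsto_const])
  ultimately have "ultimate_independence_ratio G \<le> ?i + 0"
    by (rule LIMSEQ_le) (use C in \<open>auto intro!: exI[of _ 1]\<close>)
  then show ?thesis by simp
qed

section \<open>Odd wheels and the triangle\<close>

theorem corollary1p4:
  fixes t l :: nat
  assumes "t \<ge> 2" and "l \<ge> 1"
  shows "ultimate_independence_ratio (wheel (2 * t + 1))
    \<le> real (independence_number (box_power (wheel (2 * t + 1)) l \<box> complete_graph 3))
      / (3 * (2 * real t + 2) ^ l)"
proof -
  let ?W = "wheel (2 * t + 1)" and ?K = "complete_graph 3"
  \<comment> \<open>The triangle is placed on the hub \<open>Inr 0\<close> and the adjacent rim
    vertices \<open>Inl 0\<close> and \<open>Inl 1\<close>.\<close>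
  let ?f = "\<lambda>i::nat. if i = 2 then Inr 0 else Inl i :: nat + nat"
  have W: "pair_graph ?W"
    using assms(1) by (intro pair_graph_wheel) simp
  have "ultimate_independence_ratio ?W \<le> independence_ratio (box_power ?W l \<box> ?K)"
  proof (rule ultimate_independence_ratio_le_homomorphism[OF W, where f = ?f])
    show "finite (pverts ?K)" "pverts ?K \<noteq> {}"
      by (auto simp: complete_graph_def lessThan_empty_iff)
    show "?f ` pverts ?K \<subseteq> pverts ?W"
      using assms(1) by (auto simp: complete_graph_def wheel_def graph_join_def cycle_graph_def)
    fix i j assume "(i, j) \<in> parcs ?K"
    then have "i < 3" "j < 3" "i \<noteq> j"
      by (auto simp: complete_graph_def)
    then consider "i = 0" "j = 1" | "i = 1" "j = 0" | "i = 2" "j < 2" | "i < 2" "j = 2"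
      by linarith
    then show "(?f i, ?f j) \<in> parcs ?W"
      using assms(1)
      by cases (auto simp: wheel_def graph_join_def cycle_graph_def complete_graph_def image_iff)
  qed
  also have "card (pverts (box_power ?W l \<box> ?K)) = (2 * t + 2) ^ l * 3"
    using pair_graphD(1)[OF W] card_pverts_wheel[of "2 * t + 1"]
    by (simp add: cart_prod_def card_cartesian_product pverts_box_power card_words)
      (simp add: complete_graph_def)
  then have "independence_ratio (box_power ?W l \<box> ?K)
      = real (independence_number (box_power ?W l \<box> ?K)) / (3 * (2 * real t + 2) ^ l)"
    by (simp add: independence_ratio_def mult.commute add.commute)
  finally show ?thesis .
qed

end
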